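(* Let $m,n$ be positive integers. If $\mathcal{M}\in\mathbb{R}^{[2m,n]}$ is a $T$-column sufficient tensor, then $\mathrm{TLCP}(\mathcal{M},\mathcal{Q})$ has a unique solution for every $\mathcal{Q}\in\mathbb{R}^{[m,n]}_{++}$.
   Context: Write $[n]=\{1,\dots,n\}$. $\mathbb{R}^{[m,n]}$ denotes the set of $m$-th order $n$-dimensional real tensors $\mathcal{Z}=(z_{i_1\ldots i_m})$ with $i_j\in[n]$ for $j\in[m]$, with entrywise operations and inner product $\langle\mathcal{X},\mathcal{Y}\rangle=\sum_{i_1,\dots,i_m=1}^n x_{i_1\ldots i_m}y_{i_1\ldots i_m}$. $\mathbb{R}^{[m,n]}_{+}$ (resp. $\mathbb{R}^{[m,n]}_{++}$) is the subset of tensors all of whose entries are nonnegative (resp. positive). For $\mathcal{M}=(m_{i_1\ldots i_{2m}})\in\mathbb{R}^{[2m,n]}$ and $\mathcal{Z}\in\mathbb{R}^{[m,n]}$, the tensor $\mathcal{M}\mathcal{Z}\in\mathbb{R}^{[m,n]}$ is defined by $(\mathcal{M}\mathcal{Z})_{i_1\ldots i_m}=\sum_{i_{m+1},\dots,i_{2m}=1}^n m_{i_1\ldots i_m i_{m+1}\ldots i_{2m}}z_{i_{m+1}\ldots i_{2m}}$. $\mathcal{M}\in\mathbb{R}^{[2m,n]}$ is $T$-column sufficient if for every $\mathcal{Z}\in\mathbb{R}^{[m,n]}$: if $z_{i_1\ldots i_m}(\mathcal{M}\mathcal{Z})_{i_1\ldots i_m}\le 0$ for all $i_1,\dots,i_m\in[n]$,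 then $z_{i_1\ldots i_m}(\mathcal{M}\mathcal{Z})_{i_1\ldots i_m}=0$ for all $i_1,\dots,i_m\in[n]$. $\mathrm{TLCP}(\mathcal{M},\mathcal{Q})$ is the problem of finding $\mathcal{Z}\in\mathbb{R}^{[m,n]}_{+}$ with $\mathcal{M}\mathcal{Z}+\mathcal{Q}\in\mathbb{R}^{[m,n]}_{+}$ and $\langle\mathcal{Z},\mathcal{M}\mathcal{Z}+\mathcal{Q}\rangle=0$; any such $\mathcal{Z}$ is called a solution. *)

theory Defs
  imports Complex_Main "HOL-Library.FuncSet"
begin

text \<open>
  An index tuple $(i_1,\dots,i_m)$ is a list of length \<open>m\<close>, so that concatenating two such
  lists gives an index of a tensor of order \<open>2 * m\<close>.
\<close>

definition indices :: "nat \<Rightarrow> nat \<Rightarrow> nat list set" where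
  "indices m n = {is. length is = m \<and> set is \<subseteq> {1..n}}"

text \<open>
  Tensors are functions that take the dummy value \<open>undefined\<close> outside the index set. Hence
  equality of tensors is equality of all entries, and the operations below have to restrict
  their results.
\<close>

definition tensors :: "nat \<Rightarrow> nat \<Rightarrow> (nat list \<Rightarrow> real) set" where
  "tensors m n = (indices m n \<rightarrow>\<^sub>E UNIV)"

definition nonneg_tensors :: "nat \<Rightarrow> nat \<Rightarrow> (nat list \<Rightarrow> real) set" where
  "nonneg_tensors m n = {Z \<in> tensors m n. \<forall>is \<in> indices m n. 0 \<le> Z is}"

definition pos_tensors :: "nat \<Rightarrow> nat \<Rightarrow> (nat list \<Rightarrow> real) set" where
  "pos_tensors m n = {Z \<in> tensors m n. \<forall>is \<in> indices m n. 0 < Z is}"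

definition tensor_add ::
    "nat \<Rightarrow> nat \<Rightarrow> (nat list \<Rightarrow> real) \<Rightarrow> (nat list \<Rightarrow> real) \<Rightarrow> (nat list \<Rightarrow> real)" where
  "tensor_add m n X Y = (\<lambda>is \<in> indices m n. X is + Y is)"

definition tensor_inner ::
    "nat \<Rightarrow> nat \<Rightarrow> (nat list \<Rightarrow> real) \<Rightarrow> (nat list \<Rightarrow> real) \<Rightarrow> real" where
  "tensor_inner m n X Y = (\<Sum>is \<in> indices m n. X is * Y is)"

definition tensor_apply ::
    "nat \<Rightarrow> nat \<Rightarrow> (nat list \<Rightarrow> real) \<Rightarrow> (nat list \<Rightarrow> real) \<Rightarrow> (nat list \<Rightarrow> real)" where
  "tensor_apply m n M Z = (\<lambda>is \<in> indices m n. \<Sum>js \<in> indices m n. M (is @ js) * Z js)"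

definition T_column_sufficient :: "nat \<Rightarrow> nat \<Rightarrow> (nat list \<Rightarrow> real) \<Rightarrow> bool" where
  "T_column_sufficient m n M \<longleftrightarrow>
     (\<forall>Z \<in> tensors m n.
        (\<forall>is \<in> indices m n. Z is * tensor_apply m n M Z is \<le> 0) \<longrightarrow>
        (\<forall>is \<in> indices m n. Z is * tensor_apply m n M Z is = 0))"

definition TLCP_solutions ::
    "nat \<Rightarrow> nat \<Rightarrow> (nat list \<Rightarrow> real) \<Rightarrow> (nat list \<Rightarrow> real) \<Rightarrow> (nat list \<Rightarrow> real) set" where
  "TLCP_solutions m n M Q =
     {Z \<in> nonneg_tensors m n.
        tensor_add m n (tensor_apply m n M Z) Q \<in> nonneg_tensors m n \<and>
        tensor_inner m n Z (tensor_add m n (tensor_apply m n M Z) Q) = 0}"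

end

theory Submission
  imports Defs
begin

text \<open>
  Since \<open>Q\<close> is positive, the zero tensor is always a solution, so the content is that no other
  solution exists. For nonnegative tensors a vanishing inner product means that the entrywise
  products vanish one by one, so a solution \<open>Z\<close> satisfies
  \<open>z \<cdot> (M Z) = - z \<cdot> q \<le> 0\<close> in each entry. This is exactly the hypothesis of
  \<open>T\<close>-column sufficiency, which then forces \<open>z \<cdot> q = 0\<close>, and \<open>q > 0\<close> gives \<open>z = 0\<close>.
\<close>

lemma finite_indices: "finite (indices m n)"
proof -
  have "finite {is. set is \<subseteq> {1..n} \<and> length is = m}"
    by (rule finite_lists_length_eq) simp
  then show ?thesis
    by (simp add: indices_def conj_commute)
qed

lemma TLCP_solution_complementary:
  assumes "Z \<in> TLCP_solutions m n M Q" and "is \<in> indices m n"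
  shows "Z is * (tensor_apply m n M Z is + Q is) = 0"
proof -
  have nonneg: "0 \<le> Z js * (tensor_apply m n M Z js + Q js)" if "js \<in> indices m n" for js
    using assms(1) that
    by (auto simp: TLCP_solutions_def nonneg_tensors_def tensor_add_def intro!: mult_nonneg_nonneg)
  have "(\<Sum>js \<in> indices m n. Z js * (tensor_apply m n M Z js + Q js)) = 0"
    using assms(1) by (simp add: TLCP_solutions_def tensor_inner_def tensor_add_def)
  then show ?thesis
    using nonneg assms(2) by (simp add: sum_nonneg_eq_0_iff[OF finite_indices])
qed

lemma zero_TLCP_solution:
  assumes "Q \<in> nonneg_tensors m n"
  shows "(\<lambda>is \<in> indices m n. 0) \<in> TLCP_solutions m n M Q"
  using assms
  by (auto simp: TLCP_solutions_def nonneg_tensors_def tensors_def tensor_add_def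
      tensor_inner_def tensor_apply_def)

lemma T_column_sufficient_TLCP_solution_eq_zero:
  assumes M: "T_column_sufficient m n M" and Q: "Q \<in> pos_tensors m n"
    and Z: "Z \<in> TLCP_solutions m n M Q"
  shows "Z = (\<lambda>is \<in> indices m n. 0)"
proof -
  have tensor: "Z \<in> tensors m n" and nonneg: "\<forall>is \<in> indices m n. 0 \<le> Z is"
    using Z by (auto simp: TLCP_solutions_def nonneg_tensors_def)
  have pos: "0 < Q is" if "is \<in> indices m n" for "is"
    using Q that by (simp add: pos_tensors_def)
  have product: "Z is * tensor_apply m n M Z is = - (Z is * Q is)" if "is \<in> indices m n" for "is"
    using TLCP_solution_complementary[OF Z that] by (simp add: distrib_left)
  have "Z is * tensor_apply m n M Z is \<le> 0" if "is \<in> indices m n" for "is"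
    using product[OF that] nonneg pos[OF that] that by simp
  then have "Z is * tensor_apply m n M Z is = 0" if "is \<in> indices m n" for "is"
    using M tensor that unfolding T_column_sufficient_def by blast
  then have "Z is = 0" if "is \<in> indices m n" for "is"
    using product[OF that] pos[OF that] that
    by (metis less_irrefl mult_eq_0_iff neg_equal_0_iff_equal)
  then show ?thesis
    using tensor unfolding tensors_def
    by (intro PiE_ext[where k = "indices m n" and s = "\<lambda>_. UNIV"]) auto
qed

theorem corollary4p6:
  fixes m n :: nat and M :: "nat list \<Rightarrow> real"
  assumes "0 < m" and "0 < n"
    and "M \<in> tensors (2 * m) n"
    and "T_column_sufficient m n M"
  shows "\<forall>Q \<in> pos_tensors m n. \<exists>!Z. Z \<in> TLCP_solutions m n M Q"
proof
  fix Q assume Q: "Q \<in> pos_tensors m n"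
  then have "Q \<in> nonneg_tensors m n"
    by (auto simp: pos_tensors_def nonneg_tensors_def less_imp_le)
  then show "\<exists>!Z. Z \<in> TLCP_solutions m n M Q"
    using zero_TLCP_solution T_column_sufficient_TLCP_solution_eq_zero[OF assms(4) Q] by blast
qed

end
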